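(* Let $K\ge 233$. For Online Makespan Hypergraph Coloring with $3$ colors, there exists no $r$-competitive deterministic online algorithm for any $r<3$, even when the problem is restricted to instances in which every hyperedge has at most $3$ nodes and there are at most $K$ hyperedges.
   Context: Online Makespan Hypergraph Coloring with $m$ colors: a hypergraph $\mathcal H=(V,E)$ with nodes $V=[n]$ is revealed online; nodes are revealed in the order $1,2,\dots,n$, and when node $j$ is revealed the algorithm learns the partial hyperedges $e\cap[j]$ for all $e\in E$, and must then irrevocably assign $j$ a color $c(j)\in[m]$. The objective (makespan) is $\max_{i\in[m]}\max_{e\in E}|c^{-1}(i)\cap e|$, to be minimized. A deterministic online algorithm is $r$-competitive if on every instance its objective value is at most $r$ times the minimum objective over all colorings $[n]\to[m]$. *)

theory Defs
  imports Complex_Main "HOL-Library.FuncSet" "HOL-Library.Multiset"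
begin

definition hypergraph :: "nat \<Rightarrow> nat set set \<Rightarrow> bool" where
  "hypergraph n E \<longleftrightarrow> E \<subseteq> Pow {1..n}"

text \<open>The inserted \<open>0\<close> only matters if there are no hyperedges: the objective is then \<open>0\<close>.\<close>

definition makespan :: "nat \<Rightarrow> nat set set \<Rightarrow> (nat \<Rightarrow> nat) \<Rightarrow> nat" where
  "makespan m E c = Max (insert 0 {card (c -` {i} \<inter> e) | i e. i \<in> {1..m} \<and> e \<in> E})"

definition opt_makespan :: "nat \<Rightarrow> nat \<Rightarrow> nat set set \<Rightarrow> nat" where
  "opt_makespan m n E = Min (makespan m E ` ({1..n} \<rightarrow>\<^sub>E {1..m}))"

text \<open>What is learnt when node \<open>j\<close> arrives. This is a multiset, since distinct hyperedges with
  the same nodes so far are still seen as distinct. Hyperedges that have not started yet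
  appear as empty sets.\<close>

definition partial_hyperedges :: "nat set set \<Rightarrow> nat \<Rightarrow> nat set multiset" where
  "partial_hyperedges E j = image_mset (\<lambda>e. e \<inter> {1..j}) (mset_set E)"

definition history :: "nat set set \<Rightarrow> nat \<Rightarrow> nat set multiset list" where
  "history E j = map (partial_hyperedges E) [1..<Suc j]"

text \<open>A deterministic online algorithm maps what it has learnt up to the arrival of a node to the
  color of that node. The number of nodes so far is the length of the list, and the earlier
  colors are determined by the prefixes of the list, so they are not separate arguments.\<close>

type_synonym online_rule = "nat set multiset list \<Rightarrow> nat"

definition online_algorithm :: "nat \<Rightarrow> online_rule \<Rightarrow> bool" where
  "online_algorithm m A \<longleftrightarrow> (\<forall>h. A h \<in> {1..m})"

definition online_coloring :: "online_rule \<Rightarrow> nat set set \<Rightarrow> nat \<Rightarrow> nat" where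
  "online_coloring A E j = A (history E j)"

definition competitive_on ::
  "(nat \<times> nat set set) set \<Rightarrow> nat \<Rightarrow> real \<Rightarrow> online_rule \<Rightarrow> bool" where
  "competitive_on I m r A \<longleftrightarrow>
     (\<forall>(n, E) \<in> I. real (makespan m E (online_coloring A E)) \<le> r * real (opt_makespan m n E))"

end

theory Submission
  imports Defs "HOL-Combinatorics.Transposition"
begin

text \<open>The adversary keeps the hypergraph Berge-acyclic: a new node only joins hyperedges in pairwise
  distinct components. Permuting the colors within the components then always yields an offline
  coloring without two equally colored nodes in a hyperedge, so the optimum is at most \<open>1\<close>.
  Call a monochromatic partial hyperedge with two nodes of color \<open>c\<close> a threat of color \<open>c\<close>;
  a node that joins it must avoid \<open>c\<close>. If the nodes are kept away from the colors in \<open>B\<close> by threats,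
  then \<open>2 ^ (3 - card B)\<close> nodes force a new threat whose color is not in \<open>B\<close>, as in the lower bound
  for online coloring of forests. Among \<open>19\<close> threats there are \<open>15\<close> of one color or \<open>3\<close> in each
  of two colors. Spending \<open>12\<close> threats of one color gives \<open>3\<close> threats of other colors,
  spending \<open>2\<close> threats in each of two colors gives one of the third color, and a
  node that joins threats of all three colors completes a monochromatic hyperedge. This takes
  \<open>19 * 8 + 3 * 4 + 2 + 1 = 167\<close> nodes and as many hyperedges.\<close>

section \<open>The token game between adversary and algorithm\<close>

abbreviation colors :: "nat set" where
  "colors \<equiv> {1..3}"

type_synonym token = "bool \<times> nat"

text \<open>A token \<open>(t, c)\<close> stands for a partial hyperedge with all nodes of color \<open>c\<close>, in a component of
  its own; it has two nodes if \<open>t\<close> holds, and one otherwise. In a move a new node joins the tokens \<open>S\<close>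
  and gets color \<open>c\<close>. \<open>forces P k M\<close> says that within \<open>k\<close> moves the adversary either reaches \<open>P\<close>
  or completes a monochromatic hyperedge, the latter if \<open>(True, c) \<in># S\<close>.\<close>

inductive forces :: "(token multiset \<Rightarrow> bool) \<Rightarrow> nat \<Rightarrow> token multiset \<Rightarrow> bool"
  for P where
  forces_now: "P M \<Longrightarrow> forces P k M"
| forces_move: "S \<subseteq># M \<Longrightarrow>
    (\<And>c. c \<in> colors \<Longrightarrow> (True, c) \<notin># S \<Longrightarrow>
      forces P k (add_mset ((False, c) \<in># S, c) (M - S))) \<Longrightarrow>
    forces P (Suc k) M"

lemma forces_mono_moves: "forces P k M \<Longrightarrow> k \<le> k' \<Longrightarrow> forces P k' M"
proof (induction arbitrary: k' rule: forces.induct)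
  case (forces_now M k)
  then show ?case by (simp add: forces.forces_now)
next
  case (forces_move S M k)
  then obtain l where l: "k' = Suc l" "k \<le> l" by (cases k') auto
  show ?case unfolding l(1)
    by (rule forces.forces_move[OF forces_move(1)]) (use forces_move l in auto)
qed

text \<open>Sequential composition of strategies: the first one plays only with its own tokens, so
  \<open>F\<close> waits untouched and can be spent once \<open>P\<close> holds.\<close>

lemma forces_frame:
  assumes "forces P k M" and "\<And>M'. P M' \<Longrightarrow> forces Q l (M' + F)"
  shows "forces Q (k + l) (M + F)"
  using assms(1)
proof (induction rule: forces.induct)
  case (forces_now M k)
  then show ?case using assms(2) forces_mono_moves by fastforce
next
  case (forces_move S M k)
  have "S \<subseteq># M + F"
    using forces_move(1) by (simp add: subset_mset.add_increasing2)
  moreover have "M + F - S = M - S + F"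
    using forces_move(1) by (metis subset_mset.add_diff_assoc2)
  ultimately show ?case unfolding add_Suc
    by (intro forces.forces_move) (use forces_move in auto)
qed

lemma forces_superset:
  assumes "forces P k M" "M \<subseteq># N" "\<And>M'. P M' \<Longrightarrow> forces Q l (M' + (N - M))"
  shows "forces Q (k + l) N"
  using forces_frame[OF assms(1), of Q l "N - M"] assms(2,3) by simp

section \<open>Collections of one-node tokens and of threats\<close>

definition singles :: "nat set \<Rightarrow> token multiset" where
  "singles C = image_mset (Pair False) (mset_set C)"

definition threats :: "nat multiset \<Rightarrow> token multiset" where
  "threats X = image_mset (Pair True) X"

lemma in_singles [simp]: "finite C \<Longrightarrow> (t, c) \<in># singles C \<longleftrightarrow> \<not> t \<and> c \<in> C"
  by (auto simp: singles_def)

lemma in_threats [simp]: "(t, c) \<in># threats X \<longleftrightarrow> t \<and> c \<in># X"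
  by (auto simp: threats_def)

lemma threats_plus: "threats (X + Y) = threats X + threats Y"
  by (simp add: threats_def)

lemma threats_mono: "X \<subseteq># Y \<Longrightarrow> threats X \<subseteq># threats Y"
  by (simp add: threats_def image_mset_subseteq_mono)

lemma singles_insert: "finite C \<Longrightarrow> c \<notin> C \<Longrightarrow> singles (insert c C) = add_mset (False, c) (singles C)"
  by (simp add: singles_def)

lemma singles_mono: "finite D \<Longrightarrow> C \<subseteq> D \<Longrightarrow> singles C \<subseteq># singles D"
  by (simp add: singles_def image_mset_subseteq_mono subset_imp_msubset_mset_set)

lemma singles_Un_subseteq:
  assumes "finite C" "finite D"
  shows "singles (C \<union> D) \<subseteq># singles C + singles D"
proof -
  have "mset_set (C \<union> D) \<subseteq># mset_set C + mset_set D"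
    using assms by (auto simp: subseteq_mset_def count_mset_set')
  then show ?thesis
    unfolding singles_def by (metis image_mset_subseteq_mono image_mset_union)
qed

text \<open>A node that joins one threat of each color in \<open>B\<close> must avoid
  \<open>B\<close>; a stock of \<open>n\<close> thus keeps \<open>n\<close> nodes away from
  \<open>B\<close>.\<close>

definition stock :: "nat set \<Rightarrow> nat \<Rightarrow> token multiset" where
  "stock B n = threats (repeat_mset n (mset_set B))"

lemma stock_add: "stock B (m + n) = stock B m + stock B n"
  by (simp add: stock_def threats_plus[symmetric] repeat_mset_distrib)

lemma stock_0 [simp]: "stock B 0 = {#}"
  by (simp add: stock_def threats_def)

lemma in_stock_1 [simp]: "finite B \<Longrightarrow> (t, c) \<in># stock B 1 \<longleftrightarrow> t \<and> c \<in> B"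
  by (simp add: stock_def)

section \<open>Forcing new threats\<close>

definition has_singles_or_threat :: "nat set \<Rightarrow> nat \<Rightarrow> token multiset \<Rightarrow> bool" where
  "has_singles_or_threat B m M \<longleftrightarrow>
     (\<exists>C \<subseteq> colors - B. card C = m \<and> singles C \<subseteq># M) \<or>
     (\<exists>c \<in> colors - B. (True, c) \<in># M)"

text \<open>The threats rule out \<open>B\<close>. Repeating a color of \<open>C\<close> turns that
  single into a threat; any other color makes the new node a single. The other joined tokens are
  lost, as they now share a component.\<close>

lemma forces_move_singles:
  assumes "finite B" "C \<subseteq> colors - B" "singles C + stock B 1 \<subseteq># M"
    "\<And>c. c \<in> C \<Longrightarrow> P (add_mset (True, c) (M - (singles C + stock B 1)))"
    "\<And>c. c \<in> colors - B - C \<Longrightarrow> P (add_mset (False, c) (M - (singles C + stock B 1)))"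
  shows "forces P 1 M"
proof -
  have fin: "finite C" using assms(2) by (meson finite_Diff finite_atLeastAtMost finite_subset)
  have "forces P (Suc 0) M"
  proof (rule forces_move[OF assms(3)])
    fix c assume c: "c \<in> colors" "(True, c) \<notin># singles C + stock B 1"
    then have "c \<notin> B" using assms(1) by (simp del: One_nat_def)
    moreover have "(False, c) \<in># singles C + stock B 1 \<longleftrightarrow> c \<in> C"
      using assms(1) fin by (simp del: One_nat_def)
    ultimately show "forces P 0 (add_mset ((False, c) \<in># singles C + stock B 1, c)
        (M - (singles C + stock B 1)))"
      using c assms(4,5) by (cases "c \<in> C") (auto intro!: forces_now)
  qed
  then show ?thesis by simp
qed

text \<open>As in the lower bound for online coloring of forests: run the strategy for \<open>m\<close> colors
  twice; if both runs end with the same color set, a node joined to the second one needs a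
  further color.\<close>

lemma forces_singles:
  assumes "B \<subseteq> colors" "m \<le> 3 - card B"
  shows "forces (has_singles_or_threat B m) (2 ^ m - 1) (stock B (2 ^ m - 1))"
  using assms(2)
proof (induction m)
  case 0
  show ?case
    by (auto intro!: forces_now simp: has_singles_or_threat_def singles_def)
next
  case (Suc m)
  define q where "q = (2::nat) ^ m - 1"
  have finB: "finite B" using assms(1) finite_subset by blast
  have IH: "forces (has_singles_or_threat B m) q (stock B q)"
    using Suc by (simp add: q_def)
  let ?P = "has_singles_or_threat B (Suc m)"
  have thr: "?P M" if "c \<in> colors - B" "(True, c) \<in># M" for M c
    using that by (auto simp: has_singles_or_threat_def)
  have step: "forces ?P 1 (M2 + (M1 + stock B 1))"
    if M1: "has_singles_or_threat B m M1" and M2: "has_singles_or_threat B m M2" for M1 M2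
  proof (cases "\<exists>c\<in>colors - B. (True, c) \<in># M1 + M2")
    case True
    then show ?thesis by (auto intro!: forces_now thr)
  next
    case False
    then obtain C D where
      C: "C \<subseteq> colors - B" "card C = m" "singles C \<subseteq># M1" and
      D: "D \<subseteq> colors - B" "card D = m" "singles D \<subseteq># M2"
      using M1 M2 unfolding has_singles_or_threat_def by auto
    have fin: "finite C" "finite D" using C D finite_subset by blast+
    show ?thesis
    proof (cases "C = D")
      case False
      then have "\<not> D \<subseteq> C" using C D fin card_subset_eq by metis
      then obtain x where x: "x \<in> D" "x \<notin> C" by auto
      have "singles (insert x C) \<subseteq># singles (C \<union> D)"
        by (rule singles_mono) (use x fin in auto)
      also have "\<dots> \<subseteq># singles C + singles D" by (rule singles_Un_subseteq[OF fin])
      also have "\<dots> \<subseteq># M2 + (M1 + stock B 1)"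
        using C(3) D(3) by (metis add.assoc add.commute mset_subset_eq_add_left
            subset_mset.add_mono subset_mset.order_trans)
      finally have "?P (M2 + (M1 + stock B 1))"
        unfolding has_singles_or_threat_def
        by (intro disjI1 exI[of _ "insert x C"]) (use x C D fin in auto)
      then show ?thesis by (rule forces_now)
    next
      case True
      \<comment> \<open>The node spends one of the two copies of \<open>singles C\<close>; the other
        copy stays for the case of a new color.\<close>
      let ?M = "M2 + (M1 + stock B 1)" and ?S = "singles C + stock B 1"
      obtain R1 R2 where R: "M1 = singles C + R1" "M2 = singles C + R2"
        using C(3) D(3) True by (metis subset_mset.less_eqE)
      then have MS: "?M = ?S + (singles C + R1 + R2)" by simp
      then have diff: "?M - ?S = singles C + R1 + R2" by (metis add_diff_cancel_left')
      show ?thesis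
      proof (rule forces_move_singles[OF finB C(1)])
        show "?S \<subseteq># ?M" unfolding MS by simp
        show "?P (add_mset (True, c) (?M - ?S))" if "c \<in> C" for c
          by (rule thr[of c]) (use that C in auto)
        show "?P (add_mset (False, c) (?M - ?S))" if "c \<in> colors - B - C" for c
          unfolding has_singles_or_threat_def diff
          by (intro disjI1 exI[of _ "insert c C"])
            (use that C fin in \<open>auto simp: singles_insert\<close>)
      qed
    qed
  qed
  have second: "forces ?P (q + 1) (M1 + (stock B q + stock B 1))"
    if "has_singles_or_threat B m M1" for M1
    using forces_frame[OF IH step[OF that]]
    by (simp add: ac_simps)
  have "forces ?P (q + (q + 1)) (stock B q + (stock B q + stock B 1))"
    by (rule forces_frame[OF IH second])
  moreover have "2 ^ Suc m - 1 = q + (q + 1)" by (simp add: q_def)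
  ultimately show ?case by (simp only: stock_add)
qed

text \<open>Once singles of all colors outside \<open>B\<close> are present, one more node joins
  them all, and each color left to it gives a threat.\<close>

lemma forces_threat:
  assumes "B \<subseteq> colors"
  shows "forces (\<lambda>M. \<exists>c \<in> colors - B. (True, c) \<in># M) (2 ^ (3 - card B))
    (stock B (2 ^ (3 - card B)))"
proof -
  define m where "m = 3 - card B"
  define q where "q = (2::nat) ^ m - 1"
  let ?P = "\<lambda>M. \<exists>c \<in> colors - B. (True, c) \<in># M"
  have finB: "finite B" using assms finite_subset by blast
  have m: "card (colors - B) = m" using assms finB by (simp add: card_Diff_subset m_def)
  have last: "forces ?P 1 (M + stock B 1)" if "has_singles_or_threat B m M" for M
    using that unfolding has_singles_or_threat_def
  proof (elim disjE exE conjE)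
    fix C assume C: "C \<subseteq> colors - B" "card C = m" "singles C \<subseteq># M"
    have "C = colors - B" by (rule card_subset_eq) (use C m in auto)
    show ?thesis
      by (rule forces_move_singles[OF finB C(1)])
        (use C \<open>C = colors - B\<close> in auto)
  qed (auto intro!: forces_now)
  have "forces ?P (q + 1) (stock B q + stock B 1)"
    unfolding q_def by (rule forces_frame[OF forces_singles last]) (use assms m_def in auto)
  moreover have "2 ^ m = q + 1" by (simp add: q_def)
  ultimately show ?thesis unfolding m_def[symmetric] by (simp only: stock_add)
qed

lemma forces_threats:
  assumes "B \<subseteq> colors"
  shows "forces (\<lambda>M. \<exists>X. set_mset X \<subseteq> colors - B \<and> size X = n \<and> threats X \<subseteq># M)
    (n * 2 ^ (3 - card B)) (stock B (n * 2 ^ (3 - card B)))"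
proof (induction n)
  case 0
  show ?case by (rule forces_now) (auto intro!: exI[of _ "{#}"] simp: threats_def)
next
  case (Suc n)
  define q where "q = (2::nat) ^ (3 - card B)"
  have one: "forces (\<lambda>M. \<exists>c \<in> colors - B. (True, c) \<in># M) q (stock B q)"
    unfolding q_def by (rule forces_threat[OF assms])
  \<comment> \<open>The summand \<open>0\<close> is the budget left after the new threat, in the
    shape that \<open>forces_frame\<close> asks for.\<close>
  have eq: "Suc n * q = n * q + (q + 0)" by simp
  show ?case unfolding q_def[symmetric] eq stock_add
  proof (rule forces_frame[OF Suc.IH[folded q_def]])
    fix M1 assume "\<exists>X. set_mset X \<subseteq> colors - B \<and> size X = n \<and> threats X \<subseteq># M1"
    then obtain X where X: "set_mset X \<subseteq> colors - B" "size X = n" "threats X \<subseteq># M1" by blast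
    have "forces (\<lambda>M. \<exists>X. set_mset X \<subseteq> colors - B \<and> size X = Suc n \<and> threats X \<subseteq># M)
      (q + 0) (stock B q + M1)"
    proof (rule forces_frame[OF one], elim bexE)
      fix M2 c assume c: "c \<in> colors - B" "(True, c) \<in># M2"
      have "threats (add_mset c X) = {#(True, c)#} + threats X" by (simp add: threats_def)
      also have "\<dots> \<subseteq># M2 + M1"
        by (rule subset_mset.add_mono) (use c X in auto)
      finally show "forces (\<lambda>M. \<exists>X. set_mset X \<subseteq> colors - B \<and> size X = Suc n \<and> threats X \<subseteq># M)
        0 (M2 + M1)"
        by (intro forces_now exI[of _ "add_mset c X"]) (use c X in auto)
    qed
    then show "forces (\<lambda>M. \<exists>X. set_mset X \<subseteq> colors - B \<and> size X = Suc n \<and> threats X \<subseteq># M)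
      (q + 0) (M1 + (stock B q + stock B 0))"
      by (simp add: add.commute)
  qed
qed

section \<open>Winning from sufficiently many threats\<close>

abbreviation wins :: "nat \<Rightarrow> token multiset \<Rightarrow> bool" where
  "wins \<equiv> forces (\<lambda>_. False)"

lemma stock_subseteq:
  assumes "\<And>b. b \<in> B \<Longrightarrow> n \<le> count X b"
  shows "stock B n \<subseteq># threats X"
  unfolding stock_def
  by (rule threats_mono) (use assms in \<open>auto simp: subseteq_mset_def count_mset_set'\<close>)

lemma wins_superset: "wins k M \<Longrightarrow> M \<subseteq># N \<Longrightarrow> wins k N"
  using forces_superset[of "\<lambda>_. False" k M N "\<lambda>_. False" 0] by simp

text \<open>For \<open>B = colors\<close> the goal of \<open>forces_threat\<close> is unreachable,
  so its single move wins.\<close>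

lemma wins_three_colors:
  assumes "\<And>c. c \<in> colors \<Longrightarrow> c \<in># X"
  shows "wins 1 (threats X)"
proof -
  have "wins 1 (stock colors 1)" using forces_threat[of colors] by simp
  then show ?thesis
    by (rule wins_superset) (intro stock_subseteq, use assms in \<open>simp add: Suc_le_eq\<close>)
qed

text \<open>Two nodes kept off \<open>a\<close> and \<open>b\<close> cost two threats of each and
  yield the third color; a third threat of each is left for the last node.\<close>

lemma wins_two_colors:
  assumes "a \<in> colors" "b \<in> colors" "a \<noteq> b" "count X a \<ge> 3" "count X b \<ge> 3"
  shows "wins 3 (threats X)"
proof -
  define Y where "Y = repeat_mset 2 (mset_set {a, b})"
  have Y: "Y \<subseteq># X" and cnt: "count (X - Y) a \<ge> 1" "count (X - Y) b \<ge> 1"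
    using assms by (auto simp: Y_def subseteq_mset_def count_mset_set')
  have sup: "threats Y = stock {a, b} 2" by (simp add: Y_def stock_def)
  have card: "card {a, b} = 2" using assms by simp
  have "forces (\<lambda>M. \<exists>c \<in> colors - {a, b}. (True, c) \<in># M) 2 (threats Y)"
    using forces_threat[of "{a, b}"] assms(1,2) unfolding sup card by simp
  then have "wins (2 + 1) (threats X)"
  proof (rule forces_superset)
    show "threats Y \<subseteq># threats X" by (rule threats_mono[OF Y])
    fix M assume "\<exists>c \<in> colors - {a, b}. (True, c) \<in># M"
    then obtain c where c: "c \<in> colors - {a, b}" "(True, c) \<in># M" by blast
    have "colors = {a, b, c}" by (rule sym, rule card_subset_eq) (use assms c in auto)
    then have "wins 1 (threats (add_mset c (X - Y)))"
      by (intro wins_three_colors) (use cnt in \<open>auto simp del: count_diff simp: Suc_le_eq\<close>)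
    moreover have "threats X - threats Y = threats (X - Y)"
      by (metis Y add_diff_cancel_left' subset_mset.add_diff_inverse threats_plus)
    moreover have "threats (add_mset c (X - Y)) = {#(True, c)#} + threats (X - Y)"
      by (simp add: threats_def)
    ultimately show "wins 1 (M + (threats X - threats Y))"
      by (elim wins_superset) (use c in \<open>simp add: subset_mset.add_right_mono\<close>)
  qed
  then show ?thesis by simp
qed

text \<open>Three threats outside \<open>a\<close> cost 3 * 4 = 12 threats of \<open>a\<close>. They
  show both other colors, or one of them three times; with the 3 threats of \<open>a\<close> left
  over, either case is won.\<close>

lemma wins_one_color:
  assumes "a \<in> colors" "count X a \<ge> 15"
  shows "wins 15 (threats X)"
proof -
  define Y where "Y = repeat_mset 12 (mset_set {a})"
  have Y: "Y \<subseteq># X" and cnt: "count (X - Y) a \<ge> 3"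
    using assms by (auto simp: Y_def subseteq_mset_def count_mset_set')
  have "forces (\<lambda>M. \<exists>Z. set_mset Z \<subseteq> colors - {a} \<and> size Z = 3 \<and> threats Z \<subseteq># M) 12 (threats Y)"
    using forces_threats[of "{a}" 3] assms(1) by (simp add: Y_def stock_def)
  then have "wins (12 + 3) (threats X)"
  proof (rule forces_superset)
    show "threats Y \<subseteq># threats X" by (rule threats_mono[OF Y])
    fix M assume "\<exists>Z. set_mset Z \<subseteq> colors - {a} \<and> size Z = 3 \<and> threats Z \<subseteq># M"
    then obtain Z where Z: "set_mset Z \<subseteq> colors - {a}" "size Z = 3" "threats Z \<subseteq># M" by blast
    let ?W = "Z + (X - Y)"
    have "wins 3 (threats ?W)"
    proof (cases "colors - {a} \<subseteq> set_mset Z")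
      case True
      then have "wins 1 (threats ?W)"
        using cnt by (intro wins_three_colors) (auto simp del: count_diff simp flip: count_greater_zero_iff)
      then show ?thesis by (rule forces_mono_moves) simp
    next
      case False
      then obtain d where d: "d \<in> colors" "d \<noteq> a" "d \<notin># Z" by blast
      have "card (colors - {a, d}) = 1" using assms d by (simp add: card_Diff_subset)
      then obtain b where b: "colors - {a, d} = {b}" by (meson card_1_singletonE)
      then have "set_mset Z \<subseteq> {b}" using Z d by blast
      then have "Z = replicate_mset (size Z) b" by (metis set_mset_subset_singletonD)
      then have "count Z b = 3" using Z by (metis count_replicate_mset)
      moreover have "b \<in> colors" "a \<noteq> b" using b by blast+
      ultimately show ?thesis
        using assms(1) cnt by (intro wins_two_colors[of a b]) simp_all
    qed
    moreover have "threats X - threats Y = threats (X - Y)"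
      by (metis Y add_diff_cancel_left' subset_mset.add_diff_inverse threats_plus)
    ultimately show "wins 3 (M + (threats X - threats Y))"
      by (elim wins_superset) (use Z in \<open>simp add: threats_plus subset_mset.add_right_mono\<close>)
  qed
  then show ?thesis by simp
qed

lemma wins_from_scratch: "wins 167 {#}"
proof -
  have "forces (\<lambda>M. \<exists>X. set_mset X \<subseteq> colors - {} \<and> size X = 19 \<and> threats X \<subseteq># M) 152 {#}"
    using forces_threats[of "{}" 19] by (simp add: stock_def threats_def)
  then have "wins (152 + 15) ({#} + {#})"
  proof (rule forces_frame)
    fix M assume "\<exists>X. set_mset X \<subseteq> colors - {} \<and> size X = 19 \<and> threats X \<subseteq># M"
    then obtain X where X: "set_mset X \<subseteq> colors" "size X = 19" "threats X \<subseteq># M" by auto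
    have "size X = (\<Sum>c\<in>colors. count X c)"
      unfolding size_multiset_overloaded_eq
      by (rule sum.mono_neutral_left) (use X in \<open>auto simp: not_in_iff\<close>)
    also have "\<dots> = count X 1 + count X 2 + count X 3"
      by (simp add: numeral_3_eq_3 numeral_2_eq_2)
    \<comment> \<open>Otherwise the counts would sum to at most 14 + 2 + 2 = 18.\<close>
    finally have "(\<exists>a\<in>{1,2,3}. count X a \<ge> 15) \<or>
      (count X 1 \<ge> 3 \<and> count X 2 \<ge> 3 \<or> count X 1 \<ge> 3 \<and> count X 3 \<ge> 3 \<or> count X 2 \<ge> 3 \<and> count X 3 \<ge> 3)"
      unfolding X(2) by auto
    then have "wins 15 (threats X)"
    proof (elim disjE)
      assume "\<exists>a\<in>{1,2,3}. count X a \<ge> 15"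
      then obtain a where "a \<in> {1,2,3}" "count X a \<ge> 15" by blast
      moreover from this have "a \<in> colors" by auto
      ultimately show ?thesis by (intro wins_one_color)
    qed (auto intro!: forces_mono_moves[of _ 3 _ 15]
        intro: wins_two_colors[of 1 2] wins_two_colors[of 1 3] wins_two_colors[of 2 3])
    then show "wins 15 (M + {#})" using wins_superset X(3) by simp
  qed
  then show ?thesis by simp
qed


section \<open>Indexed hyperedges and what the algorithm sees of them\<close>

text \<open>Node \<open>i\<close> is the first node of exactly one hyperedge \<open>e i\<close>, so \<open>e\<close> is injective and the number
  of hyperedges that have not started yet carries no information.\<close>

definition edge_family :: "(nat \<Rightarrow> nat set) \<Rightarrow> bool" where
  "edge_family e \<longleftrightarrow> (\<forall>i. i \<in> e i \<and> e i \<subseteq> {i..})"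

lemma inj_edge_family: "edge_family e \<Longrightarrow> inj e"
  unfolding edge_family_def by (intro injI) (metis atLeast_iff order_antisym subsetD)

definition coloring :: "online_rule \<Rightarrow> nat \<Rightarrow> (nat \<Rightarrow> nat set) \<Rightarrow> nat \<Rightarrow> nat" where
  "coloring A N e = online_coloring A (e ` {1..N})"

text \<open>Both families are injective, so their multisets of traces can be compared index by
  index. Hyperedges can thus be changed beyond \<open>j\<close> without affecting earlier
  colors.\<close>

lemma coloring_cong:
  assumes "edge_family e" "edge_family e'" "\<And>i. e i \<inter> {1..j} = e' i \<inter> {1..j}"
  shows "coloring A N e j = coloring A N e' j"
proof -
  have hist: "partial_hyperedges (f ` {1..N}) k = image_mset (\<lambda>i. f i \<inter> {1..k}) (mset_set {1..N})"
    if "edge_family f" for f k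
  proof -
    have "mset_set (f ` {1..N}) = image_mset f (mset_set {1..N})"
      using inj_edge_family[OF that] by (metis image_mset_mset_set inj_on_subset subset_UNIV)
    then show ?thesis by (simp add: partial_hyperedges_def image_mset.compositionality comp_def)
  qed
  have "e i \<inter> {1..k} = e' i \<inter> {1..k}" if "k \<le> j" for i k
    using assms(3)[of i] that by fastforce
  then have "history (e ` {1..N}) j = history (e' ` {1..N}) j"
    unfolding history_def
    by (intro map_cong) (simp_all add: hist[OF assms(1)] hist[OF assms(2)] del: One_nat_def upt_Suc)
  then show ?thesis by (simp add: coloring_def online_coloring_def)
qed

lemma coloring_in_colors: "online_algorithm 3 A \<Longrightarrow> coloring A N e j \<in> colors"
  by (simp add: coloring_def online_coloring_def online_algorithm_def)

section \<open>Positions and their extension by one node\<close>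

text \<open>After \<open>j\<close> nodes: \<open>part\<close> labels connected components, \<open>g\<close> is an offline coloring, and \<open>I\<close>
  indexes open monochromatic hyperedges in distinct components. The nodes after \<open>j\<close> are treated
  as isolated, so every position is also a finished instance.\<close>

locale position =
  fixes A :: online_rule and N j :: nat and e :: "nat \<Rightarrow> nat set"
    and part g :: "nat \<Rightarrow> nat" and I :: "nat set"
  assumes edge: "i \<in> e i" "e i \<subseteq> {i..max i j}"
    and part_le: "x \<le> j \<Longrightarrow> part x \<le> j"
    and part_new: "x > j \<Longrightarrow> part x = x"
    and part_edge: "x \<in> e i \<Longrightarrow> part x = part i"
    and g_colors: "g x \<in> colors"
    and g_inj: "inj_on g (e i)"
    and I_subset: "I \<subseteq> {1..j}"
    and part_inj: "inj_on part I"
    and open_card: "i \<in> I \<Longrightarrow> card (e i) < 3"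
    and mono: "i \<in> I \<Longrightarrow> x \<in> e i \<Longrightarrow> coloring A N e x = coloring A N e i"
begin

definition token :: "nat \<Rightarrow> token" where
  "token i = (card (e i) = 2, coloring A N e i)"

definition tokens :: "token multiset" where
  "tokens = image_mset token (mset_set I)"

lemma edge_family: "edge_family e"
  using edge by (fastforce simp: edge_family_def)

lemma finite_edge: "finite (e i)"
  using edge(2) finite_subset by blast

lemma card_edge_pos: "card (e i) > 0"
  using edge(1) finite_edge card_gt_0_iff by blast

text \<open>The hyperedge with index \<open>Suc j\<close> is already the singleton of the new node,
  so only the members of \<open>J\<close> have to grow.\<close>

definition extend :: "nat set \<Rightarrow> nat \<Rightarrow> nat set" where
  "extend J i = (if i \<in> J then insert (Suc j) (e i) else e i)"

lemma edge_le: "i \<le> j \<Longrightarrow> x \<in> e i \<Longrightarrow> x \<le> j"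
  using edge(2)[of i] by fastforce

lemma edge_new: "i > j \<Longrightarrow> e i = {i}"
  using edge[of i] by auto

context
  fixes J assumes J: "J \<subseteq> I"
begin

lemma J_le: "i \<in> J \<Longrightarrow> i \<le> j"
  using J I_subset by auto

lemma extend_edge_family: "edge_family (extend J)"
  using edge_family J_le by (fastforce simp: edge_family_def extend_def)

lemma coloring_extend:
  assumes "x \<le> j" shows "coloring A N (extend J) x = coloring A N e x"
  by (rule coloring_cong[OF extend_edge_family edge_family])
    (use assms in \<open>auto simp: extend_def\<close>)

lemma card_extend: "i \<in> J \<Longrightarrow> card (extend J i) = Suc (card (e i))"
  using edge_le[of i "Suc j"] J_le[of i] finite_edge[of i]
  by (cases "Suc j \<in> e i") (auto simp: extend_def)

lemma mono_extend:
  assumes "i \<in> J" "coloring A N (extend J) (Suc j) = coloring A N e i" "x \<in> extend J i"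
  shows "coloring A N (extend J) x = coloring A N (extend J) i"
proof -
  have "i \<le> j" "i \<in> I" using assms(1) J_le J by auto
  then show ?thesis
    using assms coloring_extend edge_le[of i x] mono[of i x]
    by (cases "x = Suc j") (auto simp: extend_def)
qed

text \<open>In each component that is merged, swap color \<open>1\<close> with one missing from the extended hyperedge;
  the new node then gets color \<open>1\<close>.\<close>

lemma offline_extend:
  obtains g' where "\<And>x. g' x \<in> colors" "\<And>i. inj_on g' (extend J i)"
proof -
  have "\<exists>q \<in> colors. q \<notin> g ` e i" if "i \<in> I" for i
  proof (rule ccontr)
    assume "\<not> ?thesis"
    then have "card colors \<le> card (g ` e i)" by (intro card_mono) (auto simp: finite_edge)
    also have "\<dots> \<le> card (e i)" by (rule card_image_le[OF finite_edge])
    finally show False using open_card[OF that] by simp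
  qed
  then obtain p where p: "\<And>i. i \<in> I \<Longrightarrow> p i \<in> colors \<and> p i \<notin> g ` e i" by metis
  \<comment> \<open>\<open>the_inv_into\<close> finds the only indexed hyperedge of component
    \<open>k\<close>; the default \<open>1\<close> makes the swap the identity on components that
    are not merged.\<close>
  define q where "q k = (if k \<in> part ` J then p (the_inv_into I part k) else 1)" for k
  have q_colors: "q k \<in> colors" for k
    using p J part_inj by (auto simp: q_def the_inv_into_f_f subset_iff)
  have q_J: "q (part i) \<notin> g ` e i" if "i \<in> J" for i
    using p that J part_inj by (auto simp: q_def the_inv_into_f_f subset_iff)
  define g' where "g' x = (if x = Suc j then 1 else transpose 1 (q (part x)) (g x))" for x
  show ?thesis
  proof
    show "g' x \<in> colors" for x
      using g_colors[of x] q_colors[of "part x"] by (auto simp: g'_def transpose_def)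
    have old: "inj_on g' (e i)" if "i \<noteq> Suc j" for i
    proof (rule inj_onI)
      fix x y assume xy: "x \<in> e i" "y \<in> e i" "g' x = g' y"
      have "Suc j \<notin> e i" using edge_le[of i "Suc j"] edge_new[of i] that by (cases "i \<le> j") auto
      then have "transpose 1 (q (part i)) (g x) = transpose 1 (q (part i)) (g y)"
        using xy part_edge[of _ i] by (auto simp: g'_def split: if_splits)
      then have "g x = g y" by (metis transpose_involutory)
      then show "x = y" using xy g_inj[of i] by (auto dest: inj_onD)
    qed
    show "inj_on g' (extend J i)" for i
    proof (cases "i \<in> J")
      case True
      have "g' x \<noteq> 1" if "x \<in> e i" for x
      proof -
        have "x \<noteq> Suc j" using edge_le[OF J_le[OF True] that] by simp
        moreover have "g x \<noteq> q (part i)" using q_J[OF True] that by (metis imageI)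
        ultimately show ?thesis
          using part_edge[OF that] by (auto simp: g'_def transpose_def)
      qed
      moreover have "inj_on g' (e i)" using old J_le[OF True] by simp
      moreover have "g' (Suc j) = 1" by (simp add: g'_def)
      ultimately show ?thesis using True by (fastforce simp: extend_def)
    next
      case False
      then show ?thesis
        using old[of i] edge_new[of "Suc j"] by (cases "i = Suc j") (auto simp: extend_def)
    qed
  qed
qed

text \<open>The joined hyperedges and that of the new node fall into one component, so only one of
  them, \<open>new\<close>, stays indexed: the node's own hyperedge or a joined single of its
  color.\<close>

lemma position_extend:
  assumes new: "new \<in> insert (Suc j) J"
    "new \<in> J \<Longrightarrow> card (e new) = 1 \<and> coloring A N (extend J) (Suc j) = coloring A N e new"
  obtains part' g' where "position A N (Suc j) (extend J) part' g' (insert new (I - J))"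
proof -
  obtain g' where g': "\<And>x. g' x \<in> colors" "\<And>i. inj_on g' (extend J i)"
    using offline_extend by blast
  \<comment> \<open>Nodes up to \<open>j\<close> have labels at most \<open>j\<close>, so
    \<open>Suc j\<close> is a fresh label for the merged component.\<close>
  define part' where "part' x = (if x = Suc j \<or> part x \<in> part ` J then Suc j else part x)" for x
  have cJ: "part i \<in> part ` J \<longleftrightarrow> i \<in> J" if "i \<in> I" for i
    using that J part_inj by (meson inj_on_image_mem_iff)
  have part'_new: "part' new = Suc j" using new(1) by (auto simp: part'_def)
  have part'_old: "part' i = part i \<and> part i \<le> j" if "i \<in> I - J" for i
    using that cJ I_subset part_le by (auto simp: part'_def)
  have old: "extend J i = e i" "i \<le> j" if "i \<in> I - J" for i
    using that I_subset by (auto simp: extend_def)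
  have "position A N (Suc j) (extend J) part' g' (insert new (I - J))"
  proof
    fix i x
    show "i \<in> extend J i" using edge(1) by (simp add: extend_def)
    show "extend J i \<subseteq> {i..max i (Suc j)}"
      using subset_trans[OF edge(2)[of i], of "{i..max i (Suc j)}"] J_le[of i]
      by (auto simp: extend_def)
    show "part' x \<le> Suc j" if "x \<le> Suc j"
      using that part_le[of x] by (auto simp: part'_def)
    show "part' x = x" if "x > Suc j"
    proof -
      have "part x \<notin> part ` J"
        using that part_new[of x] J_le part_le by fastforce
      then show ?thesis using that part_new[of x] by (simp add: part'_def)
    qed
    show "part' x = part' i" if "x \<in> extend J i"
    proof (cases "x = Suc j \<and> i \<in> J")
      case True
      then show ?thesis by (simp add: part'_def)
    next
      case False
      then have x: "x \<in> e i" using that by (auto simp: extend_def split: if_splits)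
      then have "x = Suc j \<longleftrightarrow> i = Suc j"
        using edge_le[of i x] edge_new[of i] by (cases "i \<le> j") auto
      then show ?thesis using part_edge[OF x] by (simp add: part'_def)
    qed
    show "g' x \<in> colors" "inj_on g' (extend J i)" by (rule g')+
    show "insert new (I - J) \<subseteq> {1..Suc j}" using new(1) J I_subset by auto
    show "inj_on part' (insert new (I - J))"
    proof -
      have "inj_on part' (I - J)"
        using part_inj part'_old by (simp add: inj_on_def)
      moreover have "part' new \<notin> part' ` (I - J)" using part'_new part'_old by fastforce
      ultimately show ?thesis by auto
    qed
    have enew: "extend J (Suc j) = {Suc j}"
      using J_le[of "Suc j"] edge_new[of "Suc j"] by (auto simp: extend_def)
    show "card (extend J i) < 3" if "i \<in> insert new (I - J)"
    proof (cases "i \<in> I - J")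
      case True
      then show ?thesis using old(1)[OF True] open_card[of i] by simp
    next
      case False
      then have "i = new" using that by blast
      then show ?thesis using new enew card_extend[of new] by (cases "new \<in> J") auto
    qed
    show "coloring A N (extend J) x = coloring A N (extend J) i"
      if "i \<in> insert new (I - J)" "x \<in> extend J i"
    proof (cases "i \<in> I - J")
      case True
      then show ?thesis using that old[of i] mono[of i x] coloring_extend edge_le[of i x] by auto
    next
      case False
      then have "i = new" using that by blast
      show ?thesis
      proof (cases "new \<in> J")
        case True
        then show ?thesis
          using new(2) mono_extend[of new x] that(2) unfolding \<open>i = new\<close> by blast
      next
        case False
        then have "x = i" using new(1) that(2) enew unfolding \<open>i = new\<close> by simp
        then show ?thesis by simp
      qed
    qed
  qed
  then show ?thesis using that by blast
qed

end

end

section \<open>Playing the strategy against an algorithm\<close>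

lemma subset_image_mset_set:
  assumes "S \<subseteq># image_mset f (mset_set I)" "finite I"
  obtains J where "J \<subseteq> I" "S = image_mset f (mset_set J)"
proof -
  obtain R where "image_mset f (mset_set I) = S + R"
    using assms(1) by (auto simp: mset_subset_eq_exists_conv)
  then obtain U V where UV: "mset_set I = U + V" "S = image_mset f U"
    by (metis image_mset_eq_plusD)
  then have U: "U \<subseteq># mset_set I" by simp
  \<comment> \<open>\<open>mset_set I\<close> has no repetitions, so neither has
    \<open>U\<close>.\<close>
  have "U = mset_set (set_mset U)"
  proof (rule multiset_eqI)
    fix x
    have "count U x \<le> 1" using mset_subset_eq_count[OF U, of x] by (simp add: count_mset_set' split: if_splits)
    then show "count U x = count (mset_set (set_mset U)) x"
      by (cases "count U x") (auto simp: count_mset_set' simp flip: count_greater_zero_iff)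
  qed
  moreover have "set_mset U \<subseteq> I" using set_mset_mono[OF U] assms(2) by simp
  ultimately show ?thesis using that UV(2) by metis
qed

text \<open>Induction on the strategy: the algorithm's color for the next node is its answer to the
  move. The conclusion keeps a position since that supplies the offline coloring.\<close>

lemma wins_imp_monochromatic_edge:
  assumes "wins k M" "position A N j e part g I" "M = position.tokens A N e I" "j + k \<le> N"
    "online_algorithm 3 A"
  shows "\<exists>j e part g I. position A N j e part g I \<and> j \<le> N \<and>
    (\<exists>i \<in> {1..N}. card (e i) = 3 \<and> (\<forall>x \<in> e i. coloring A N e x = coloring A N e i))"
  using assms(1-4)
proof (induction arbitrary: j e part g I rule: forces.induct)
  case (forces_now M k)
  then show ?case by simp
next
  case (forces_move S M k)
  interpret position A N j e part g I by (rule forces_move.prems)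
  have fin: "finite I" using I_subset finite_subset by blast
  obtain J where J: "J \<subseteq> I" "S = image_mset token (mset_set J)"
    using subset_image_mset_set[of S token I] forces_move.hyps(1) forces_move.prems(2) fin
    by (auto simp: tokens_def)
  have finJ: "finite J" using J(1) fin finite_subset by blast
  \<comment> \<open>The answer is read off the finished instance \<open>extend J\<close>; by
    \<open>coloring_extend\<close>, later moves will not change it.\<close>
  define c where "c = coloring A N (extend J) (Suc j)"
  have c: "c \<in> colors" unfolding c_def by (rule coloring_in_colors[OF assms(5)])
  have jN: "Suc j + k \<le> N" using forces_move.prems by simp
  show ?case
  proof (cases "(True, c) \<in># S")
    case True
    then obtain i where i: "i \<in> J" "card (e i) = 2" "coloring A N e i = c"
      unfolding J(2) using finJ by (auto simp: token_def)
    obtain part' g' where "position A N (Suc j) (extend J) part' g' (insert (Suc j) (I - J))"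
      using position_extend[OF J(1), of "Suc j"] J_le[OF J(1), of "Suc j"] by auto
    moreover have "card (extend J i) = 3" using card_extend[OF J(1) i(1)] i(2) by simp
    moreover have "\<forall>x \<in> extend J i. coloring A N (extend J) x = coloring A N (extend J) i"
      using mono_extend[OF J(1) i(1)] i(3) c_def by auto
    moreover have "i \<in> {1..N}" using i(1) J(1) I_subset jN by fastforce
    ultimately show ?thesis using jN by (meson add_leD1)
  next
    case False
    \<comment> \<open>A joined token of color \<open>c\<close> that is not a threat has one node and
      stays indexed; if there is none, the node's own hyperedge is the new token.\<close>
    obtain new where new: "new \<in> insert (Suc j) J" "new \<in> J \<longleftrightarrow> (False, c) \<in># S"
      "new \<in> J \<Longrightarrow> card (e new) = 1 \<and> coloring A N e new = c"
    proof (cases "(False, c) \<in># S")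
      case True
      then obtain i where i: "i \<in> J" "card (e i) \<noteq> 2" "coloring A N e i = c"
        unfolding J(2) using finJ by (auto simp: token_def)
      then have "card (e i) = 1" using open_card[of i] card_edge_pos[of i] J(1) by force
      then show ?thesis using that i True by blast
    next
      case False
      then show ?thesis using that[of "Suc j"] J_le[OF J(1), of "Suc j"] by auto
    qed
    obtain part' g' where pos: "position A N (Suc j) (extend J) part' g' (insert new (I - J))"
      using position_extend[OF J(1) new(1)] new(3) c_def by metis
    have newI: "new \<notin> I - J" using new(1) I_subset by auto
    have tok_new: "position.token A N (extend J) new = ((False, c) \<in># S, c)"
    proof (cases "new \<in> J")
      case True
      then show ?thesis
        using new card_extend[OF J(1) True] coloring_extend[OF J(1) J_le[OF J(1) True]]
        by (simp add: position.token_def[OF pos])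
    next
      case False
      then have "new = Suc j" using new(1) by simp
      then show ?thesis
        using new(2) False edge_new[of "Suc j"]
        by (simp add: position.token_def[OF pos] extend_def c_def)
    qed
    have tok_old: "position.token A N (extend J) i = token i" if "i \<in> I - J" for i
      using that I_subset coloring_extend[OF J(1), of i]
      by (auto simp: position.token_def[OF pos] token_def extend_def)
    have "M - S = image_mset token (mset_set (I - J))"
    proof -
      have "mset_set I = mset_set J + mset_set (I - J)"
        using mset_set_Union[of J "I - J"] J(1) fin finJ by (simp add: Un_absorb1 Diff_disjoint)
      then show ?thesis using forces_move.prems(2) J(2) by (simp add: tokens_def)
    qed
    also have "\<dots> = image_mset (position.token A N (extend J)) (mset_set (I - J))"
      by (rule image_mset_cong) (use tok_old fin in auto)
    finally have "add_mset ((False, c) \<in># S, c) (M - S) =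
        position.tokens A N (extend J) (insert new (I - J))"
      using tok_new newI fin by (simp add: position.tokens_def[OF pos])
    then show ?thesis
      using forces_move.IH[OF c False pos] jN by blast
  qed
qed

lemma position_initial: "position A N 0 (\<lambda>i. {i}) (\<lambda>x. x) (\<lambda>_. 1) {}"
  by unfold_locales auto

section \<open>Makespan bounds and conclusion\<close>

lemma finite_makespan_set:
  fixes c :: "nat \<Rightarrow> nat"
  shows "finite E \<Longrightarrow> finite {card (c -` {i} \<inter> e) |i e. i \<in> {1..m} \<and> e \<in> E}"
  by (rule finite_subset[of _ "(\<lambda>(i, e). card (c -` {i} \<inter> e)) ` ({1..m} \<times> E)"])
    (auto intro!: finite_imageI simp del: One_nat_def)

lemma makespan_ge:
  "finite E \<Longrightarrow> e \<in> E \<Longrightarrow> i \<in> {1..m} \<Longrightarrow> card (c -` {i} \<inter> e) \<le> makespan m E c"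
  unfolding makespan_def
  by (rule Max_ge) (use finite_makespan_set[of E c m] in \<open>auto simp del: One_nat_def\<close>)

lemma opt_makespan_le_1:
  assumes "hypergraph n E" "finite E" "\<And>x. g x \<in> {1..m}" "\<And>e. e \<in> E \<Longrightarrow> inj_on g e"
  shows "opt_makespan m n E \<le> 1"
proof -
  \<comment> \<open>The optimum ranges over extensional functions; the restriction agrees with
    \<open>g\<close> on all hyperedges.\<close>
  let ?g = "restrict g {1..n}"
  have "makespan m E ?g \<le> 1"
    unfolding makespan_def
  proof (rule Max.boundedI)
    fix a assume "a \<in> insert 0 {card (?g -` {i} \<inter> e) |i e. i \<in> {1..m} \<and> e \<in> E}"
    then consider "a = 0" | i e where "a = card (?g -` {i} \<inter> e)" "e \<in> E" by auto
    then show "a \<le> 1"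
    proof cases
      case 2
      have sub: "e \<subseteq> {1..n}" using 2 assms(1) by (auto simp: hypergraph_def)
      have "x = y" if "x \<in> ?g -` {i} \<inter> e" "y \<in> ?g -` {i} \<inter> e" for x y
        using that sub assms(4)[OF 2(2)] by (auto dest!: inj_onD[of g e x y] simp: subset_iff)
      then have "card (?g -` {i} \<inter> e) \<le> Suc 0"
        using finite_subset[OF sub] by (subst card_le_Suc0_iff_eq) blast+
      then show ?thesis using 2 by simp
    qed simp
  qed (use finite_makespan_set[OF assms(2)] in auto)
  moreover have "opt_makespan m n E \<le> makespan m E ?g"
    unfolding opt_makespan_def
    by (rule Min_le) (use assms(3) in \<open>auto intro!: finite_PiE imageI\<close>)
  ultimately show ?thesis by simp
qed

theorem mainTheorem9:
  fixes K :: nat and r :: real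
  assumes "K \<ge> 233" and "r < 3"
  shows "\<not> (\<exists>A. online_algorithm 3 A \<and>
    competitive_on {(n, E). hypergraph n E \<and> (\<forall>e\<in>E. card e \<le> 3) \<and> card E \<le> K} 3 r A)"
proof
  \<comment> \<open>One node for each move of \<open>wins_from_scratch\<close>; the family then has
    at most 167 hyperedges.\<close>
  define N where "N = (167::nat)"
  assume "\<exists>A. online_algorithm 3 A \<and>
    competitive_on {(n, E). hypergraph n E \<and> (\<forall>e\<in>E. card e \<le> 3) \<and> card E \<le> K} 3 r A"
  then obtain A where A: "online_algorithm 3 A" and
    competitive: "competitive_on {(n, E). hypergraph n E \<and> (\<forall>e\<in>E. card e \<le> 3) \<and> card E \<le> K} 3 r A"
    by blast
  have "{#} = position.tokens A N (\<lambda>i. {i}) {}"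
    by (simp add: position.tokens_def[OF position_initial])
  from wins_imp_monochromatic_edge[OF wins_from_scratch position_initial this _ A]
  obtain j e part g I i where pos: "position A N j e part g I" and "j \<le> N" and
    i: "i \<in> {1..N}" "card (e i) = 3" "\<forall>x \<in> e i. coloring A N e x = coloring A N e i"
    unfolding N_def by auto
  interpret position A N j e part g I by (rule pos)
  define E where "E = e ` {1..N}"
  have fin: "finite E" by (simp add: E_def)
  have hyp: "hypergraph N E"
    using edge(2) \<open>j \<le> N\<close> by (fastforce simp: hypergraph_def E_def)
  have card_le: "card f \<le> 3" if f: "f \<in> E" for f
  proof -
    \<comment> \<open>A hyperedge on which a coloring with three colors is injective has at most
      three nodes.\<close>
    have "card f = card (g ` f)" using f g_inj by (auto simp: E_def card_image)
    also have "\<dots> \<le> card colors" by (rule card_mono) (use g_colors in auto)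
    finally show ?thesis by simp
  qed
  have "card E \<le> N" unfolding E_def using card_image_le[of "{1..N}" e] by simp
  then have "card E \<le> K" using assms(1) by (simp add: N_def)
  then have "real (makespan 3 E (online_coloring A E)) \<le> r * real (opt_makespan 3 N E)"
    using competitive hyp card_le by (auto simp: competitive_on_def)
  moreover have "3 \<le> makespan 3 E (online_coloring A E)"
  proof -
    let ?c = "online_coloring A E"
    have "?c -` {?c i} \<inter> e i = e i" using i(3) by (auto simp: coloring_def E_def)
    moreover have "?c i \<in> {1..3}" using coloring_in_colors[OF A, of N e i] by (simp add: coloring_def E_def)
    ultimately show ?thesis
      using makespan_ge[OF fin, of "e i" "?c i" 3 ?c] i by (auto simp: E_def)
  qed
  moreover have "opt_makespan 3 N E \<le> 1"
    by (rule opt_makespan_le_1[OF hyp fin g_colors]) (use g_inj in \<open>auto simp: E_def\<close>)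
  \<comment> \<open>\<open>r\<close> may be negative, so the bound on the optimum cannot simply be
    multiplied by it.\<close>
  then have "opt_makespan 3 N E = 0 \<or> opt_makespan 3 N E = 1" by auto
  then have "r * real (opt_makespan 3 N E) < 3" using assms(2) by auto
  ultimately show False by linarith
qed

end
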